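(* Let $r,s\in\mathbb{Z}$ and let $F\in\mathcal{M}^!_{r,s}$ (the space of real-analytic modular forms of weights $(r,s)$ for $SL_2(\mathbb{Z})$) have an expansion of the form $$F(z)=\sum_{k\in S}y^k\sum_{n\geq n_0}a_n^{(k)}q^{n} + \sum_{k\in S}y^k\sum_{n\geq n_0}b_n^{(k)}\bar q^{n},$$ with $S\subset\mathbb{Z}$ a finite subset, $n_0\in\mathbb{Z}$ and $a_n^{(k)},b_n^{(k)}\in\mathbb{C}$. Then, for every $\varphi\in\mathcal{F}_F$ such that $\varphi|_{2-r-s} W_1\in\mathcal{F}_F$, one has the functional equation $$L_{F}(\varphi)=i^{r-s}L_{F}(\varphi|_{2-r-s} W_1).$$
   Context: Notation: $z=x+iy\in\mathbb{H}$ (the upper half-plane), $q=e^{2\pi i z}$. $\mathcal{M}^!_{r,s}$ is the space of real-analytic functions $F:\mathbb{H}\to\mathbb{C}$ such that $F(\gamma z)(cz+d)^{-r}(c\bar z+d)^{-s}=F(z)$ for all $z\in\mathbb{H}$ and $\gamma=\begin{pmatrix}a&b\\c&d\end{pmatrix}\in SL_2(\mathbb{Z})$, and such that $F$ has an expansion $F(z)=\sum_{|j|\le N_0}y^j\big(\sum_{m,n\ge -N_0'}a_{m,n}^{(j)}q^m\bar q^n\big)$ for some $N_0,N_0'\in\mathbb{N}$, $a_{m,n}^{(j)}\in\mathbb{C}$. Laplace transform: $(\mathcal{L}\varphi)(s)=\int_0^\infty e^{-st}\varphi(t)\,dt$ for $s\in\mathbb{C}$ for which the integral converges absolutely. For a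 function $\varphi$ put $\varphi_{k+1}(y)=y^k\varphi(y)$. For an integer $a$, $(\varphi|_aW_1)(y)=y^{-a}\varphi(1/y)$ for $y>0$. $\mathcal{F}_F$ is the space of piecewise smooth complex-valued functions $\varphi$ on $\mathbb{R}$ (only the values on $(0,\infty)$ enter) such that the integral defining $(\mathcal{L}\varphi)(s)$ converges absolutely for all $s$ with $\mathrm{Re}(s)\ge 2\pi n_0$ and $$\sum_{k\in S}\sum_{n\geq n_0}|a_{n}^{(k)}|\,\mathcal{L}|\varphi_{k+1}|(2\pi n)+\sum_{k\in S}\sum_{n\geq n_0}|b_{n}^{(k)}|\,\mathcal{L}|\varphi_{k+1}|(2\pi n)<\infty.$$ For $\varphi\in\mathcal{F}_F$ the $L$-series is $$L_F(\varphi)=\sum_{k\in S}\sum_{n\geq n_0}a_{n}^{(k)}\,\mathcal{L}\varphi_{k+1}(2\pi n)+\sum_{k\in S}\sum_{n\geq n_0}b_{n}^{(k)}\,\mathcal{L}\varphi_{k+1}(2\pi n).$$ *)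

theory Defs
  imports "HOL-Analysis.Analysis"
begin

abbreviation upper_half_plane :: "complex set" where
  "upper_half_plane \<equiv> {z. Im z > 0}"

abbreviation nome :: "complex \<Rightarrow> complex" where
  "nome z \<equiv> exp (2 * of_real pi * \<i> * z)"

text \<open>Real-analyticity in the two real variables \<open>x = Re z\<close> and \<open>y = Im z\<close>.\<close>

definition real_analytic_on :: "(complex \<Rightarrow> complex) \<Rightarrow> complex set \<Rightarrow> bool" where
  "real_analytic_on F U \<longleftrightarrow>
     (\<forall>w\<in>U. \<exists>e>0. \<exists>c :: nat \<Rightarrow> nat \<Rightarrow> complex. \<forall>z\<in>ball w e.
        ((\<lambda>(m, n). c m n * of_real (Re z - Re w) ^ m * of_real (Im z - Im w) ^ n)
           has_sum F z) UNIV)"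

text \<open>Only the restriction of \<open>F\<close> to the upper half-plane matters.\<close>

definition real_analytic_modular_forms :: "int \<Rightarrow> int \<Rightarrow> (complex \<Rightarrow> complex) set" where
  "real_analytic_modular_forms r s = {F.
     real_analytic_on F upper_half_plane \<and>
     (\<forall>a b c d :: int. a * d - b * c = 1 \<longrightarrow>
        (\<forall>z\<in>upper_half_plane.
           F ((of_int a * z + of_int b) / (of_int c * z + of_int d))
             * (of_int c * z + of_int d) powi (- r)
             * (of_int c * cnj z + of_int d) powi (- s) = F z)) \<and>
     (\<exists>(N0 :: nat) (N1 :: nat) (a :: int \<Rightarrow> int \<Rightarrow> int \<Rightarrow> complex).
        \<forall>z\<in>upper_half_plane.
          (\<forall>j\<in>{- int N0..int N0}.
             (\<lambda>(m, n). a j m n * nome z powi m * cnj (nome z) powi n)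
               summable_on ({- int N1..} \<times> {- int N1..})) \<and>
          F z = (\<Sum>j\<in>{- int N0..int N0}. of_real (Im z) powi j *
             (\<Sum>\<^sub>\<infinity>(m, n)\<in>{- int N1..} \<times> {- int N1..}.
                a j m n * nome z powi m * cnj (nome z) powi n)))}"

text \<open>
  In the following, \<open>a k n\<close> and \<open>b k n\<close> are the coefficients of \<open>y\<^sup>k q\<^sup>n\<close> and of \<open>y\<^sup>k\<close> times the
  \<open>n\<close>-th power of the conjugate of \<open>q\<close>. The test functions and the \<open>L\<close>-series depend on \<open>F\<close> only
  through these data, so they are parameterised by them.
\<close>

definition has_expansion ::
  "(complex \<Rightarrow> complex) \<Rightarrow> int set \<Rightarrow> int \<Rightarrow> (int \<Rightarrow> int \<Rightarrow> complex) \<Rightarrow> (int \<Rightarrow> int \<Rightarrow> complex) \<Rightarrow> bool"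
where
  "has_expansion F S n0 a b \<longleftrightarrow>
     (\<forall>z\<in>upper_half_plane.
        (\<forall>k\<in>S. (\<lambda>n. a k n * nome z powi n) summable_on {n0..} \<and>
                (\<lambda>n. b k n * cnj (nome z) powi n) summable_on {n0..}) \<and>
        F z = (\<Sum>k\<in>S. of_real (Im z) powi k * (\<Sum>\<^sub>\<infinity>n\<in>{n0..}. a k n * nome z powi n))
            + (\<Sum>k\<in>S. of_real (Im z) powi k * (\<Sum>\<^sub>\<infinity>n\<in>{n0..}. b k n * cnj (nome z) powi n)))"

definition laplace_abs_conv :: "(real \<Rightarrow> complex) \<Rightarrow> complex \<Rightarrow> bool" where
  "laplace_abs_conv \<phi> s \<longleftrightarrow> set_integrable lborel {0<..} (\<lambda>t. exp (- s * of_real t) * \<phi> t)"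

definition laplace :: "(real \<Rightarrow> complex) \<Rightarrow> complex \<Rightarrow> complex" where
  "laplace \<phi> s = (LINT t:{0<..}|lborel. exp (- s * of_real t) * \<phi> t)"

text \<open>The Laplace transform of \<open>\<bar>\<phi>\<bar>\<close> at a real point; its value is \<open>\<infinity>\<close> if the integral diverges.\<close>

definition laplace_abs :: "(real \<Rightarrow> complex) \<Rightarrow> real \<Rightarrow> ennreal" where
  "laplace_abs \<phi> x = (\<integral>\<^sup>+t\<in>{0<..}. ennreal (exp (- x * t) * norm (\<phi> t)) \<partial>lborel)"

text \<open>\<open>times_power k \<phi>\<close> is \<open>\<phi>\<^bsub>k+1\<^esub>\<close>.\<close>

definition times_power :: "int \<Rightarrow> (real \<Rightarrow> complex) \<Rightarrow> real \<Rightarrow> complex" where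
  "times_power k \<phi> y = of_real y powi k * \<phi> y"

definition slash_W1 :: "(real \<Rightarrow> complex) \<Rightarrow> int \<Rightarrow> real \<Rightarrow> complex" where
  "slash_W1 \<phi> a y = of_real y powi (- a) * \<phi> (1 / y)"

text \<open>
  Piecewise smoothness on \<open>(0,\<infinity>)\<close>: away from a set \<open>B\<close> of breakpoints, finite in every compact
  subinterval, \<open>\<phi>\<close> is infinitely differentiable with \<open>n\<close>-th derivative \<open>D n\<close>, and every derivative
  has one-sided limits at every breakpoint. Breakpoints may accumulate at \<open>0\<close> and nothing is
  required at \<open>0\<close> itself, so that the condition is invariant under \<open>y \<mapsto> 1/y\<close>.
\<close>

definition piecewise_smooth :: "(real \<Rightarrow> complex) \<Rightarrow> bool" where
  "piecewise_smooth \<phi> \<longleftrightarrow>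
     (\<exists>B\<subseteq>{0<..}. (\<forall>u v. 0 < u \<longrightarrow> finite (B \<inter> {u..v})) \<and>
        (\<exists>D :: nat \<Rightarrow> real \<Rightarrow> complex.
           (\<forall>t\<in>{0<..} - B. D 0 t = \<phi> t) \<and>
           (\<forall>n. \<forall>t\<in>{0<..} - B. (D n has_vector_derivative D (Suc n) t) (at t)) \<and>
           (\<forall>n. \<forall>t\<in>B. (\<exists>l. (D n \<longlongrightarrow> l) (at_left t)) \<and> (\<exists>l. (D n \<longlongrightarrow> l) (at_right t)))))"

text \<open>
  The sums are taken in \<open>[0,\<infinity>]\<close>, with \<open>0 \<cdot> \<infinity> = 0\<close>: finiteness forces the integrals for
  \<open>\<phi>\<^bsub>k+1\<^esub>\<close> to converge absolutely at \<open>2\<pi>n\<close> wherever the coefficient is nonzero.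
\<close>

definition test_functions ::
  "int set \<Rightarrow> int \<Rightarrow> (int \<Rightarrow> int \<Rightarrow> complex) \<Rightarrow> (int \<Rightarrow> int \<Rightarrow> complex) \<Rightarrow> (real \<Rightarrow> complex) set"
where
  "test_functions S n0 a b = {\<phi>.
     piecewise_smooth \<phi> \<and>
     (\<forall>s. Re s \<ge> 2 * pi * of_int n0 \<longrightarrow> laplace_abs_conv \<phi> s) \<and>
     (\<Sum>k\<in>S. \<Sum>\<^sub>\<infinity>n\<in>{n0..}.
        ennreal (norm (a k n)) * laplace_abs (times_power k \<phi>) (2 * pi * of_int n))
     + (\<Sum>k\<in>S. \<Sum>\<^sub>\<infinity>n\<in>{n0..}.
        ennreal (norm (b k n)) * laplace_abs (times_power k \<phi>) (2 * pi * of_int n)) < \<infinity>}"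

definition L_series ::
  "int set \<Rightarrow> int \<Rightarrow> (int \<Rightarrow> int \<Rightarrow> complex) \<Rightarrow> (int \<Rightarrow> int \<Rightarrow> complex) \<Rightarrow> (real \<Rightarrow> complex) \<Rightarrow> complex"
where
  "L_series S n0 a b \<phi> =
     (\<Sum>k\<in>S. \<Sum>\<^sub>\<infinity>n\<in>{n0..}. a k n * laplace (times_power k \<phi>) (2 * of_real pi * of_int n))
   + (\<Sum>k\<in>S. \<Sum>\<^sub>\<infinity>n\<in>{n0..}. b k n * laplace (times_power k \<phi>) (2 * of_real pi * of_int n))"

end

theory Submission
  imports Defs
begin

text \<open>
  The summability condition on test functions lets one exchange sum and integral, so that
  \<open>L\<^sub>F(\<phi>) = \<integral>\<^sub>0\<^sup>\<infinity> F(it) \<phi>(t) dt\<close>. Modularity under \<open>z \<mapsto> -1/z\<close> on the imaginary axis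
  reads \<open>F(i/t) = i\<^bsup>r-s\<^esup> t\<^bsup>r+s\<^esup> F(it)\<close>, and the substitution \<open>t \<mapsto> 1/t\<close> then produces the
  slash action of weight \<open>2 - r - s\<close>, the \<open>2\<close> coming from \<open>d(1/t) = -t\<^bsup>-2\<^esup> dt\<close>.
\<close>

section \<open>Interchange of infinite sums and integrals\<close>

lemma infsum_eq_suminf:
  fixes f :: "nat \<Rightarrow> 'a :: banach"
  assumes "summable (\<lambda>i. norm (f i))"
  shows "(\<Sum>\<^sub>\<infinity>i\<in>UNIV. f i) = (\<Sum>i. f i)"
  using norm_summable_imp_has_sum[OF assms summable_sums[OF summable_norm_cancel[OF assms]]]
  by (rule infsumI)

text \<open>Finiteness of the total of the L1 norms allows dominated convergence for ordinary
  series. Assumption \<open>pt\<close> identifies the unordered sum with the series at every point,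
  so both integrands agree everywhere and not merely almost everywhere.\<close>

lemma integral_infsum_nat:
  fixes f :: "nat \<Rightarrow> 'a \<Rightarrow> 'b :: {banach, second_countable_topology}"
  assumes meas: "\<And>i. f i \<in> borel_measurable M"
    and fin: "(\<Sum>\<^sub>\<infinity>i\<in>UNIV. \<integral>\<^sup>+x. ennreal (norm (f i x)) \<partial>M) < \<infinity>"
    and pt: "\<And>x. x \<in> space M \<Longrightarrow> (\<lambda>i. norm (f i x)) summable_on UNIV"
  shows "integrable M (\<lambda>x. \<Sum>\<^sub>\<infinity>i\<in>UNIV. f i x)"
    and "(\<Sum>\<^sub>\<infinity>i\<in>UNIV. integral\<^sup>L M (f i)) = (LINT x|M. (\<Sum>\<^sub>\<infinity>i\<in>UNIV. f i x))"
proof -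
  let ?N = "\<lambda>i. \<integral>\<^sup>+x. ennreal (norm (f i x)) \<partial>M"
  \<comment> \<open>In [0, infinity] every family is summable, so the unordered sum is the limit of
    its partial sums.\<close>
  have "?N sums (\<Sum>\<^sub>\<infinity>i\<in>UNIV. ?N i)"
    by (intro has_sum_imp_sums has_sum_infsum nonneg_summable_on_complete) auto
  then have Nsum: "(\<Sum>i. ?N i) \<noteq> \<infinity>"
    using fin by (auto dest: sums_unique)
  have Nfin: "?N i < \<infinity>" for i
    using Nsum ennreal_suminf_lessD[of ?N \<infinity> i] by (simp add: top.not_eq_extremum)
  have int: "integrable M (f i)" for i
    using meas Nfin by (simp add: integrable_iff_bounded)
  have N_eq: "?N i = ennreal (LINT x|M. norm (f i x))" for i
    using int by (intro nn_integral_eq_integral) auto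
  have sumN: "summable (\<lambda>i. LINT x|M. norm (f i x))"
    using Nsum unfolding N_eq by (intro summable_suminf_not_top) auto
  have sumpt: "summable (\<lambda>i. norm (f i x))" if "x \<in> space M" for x
    using pt[OF that] by (rule summable_on_imp_summable)
  then have AEpt: "AE x in M. summable (\<lambda>i. norm (f i x))" by auto
  have inf_pt: "(\<Sum>\<^sub>\<infinity>i\<in>UNIV. f i x) = (\<Sum>i. f i x)" if "x \<in> space M" for x
    by (rule infsum_eq_suminf[OF sumpt[OF that]])
  have cong: "integrable M (\<lambda>x. \<Sum>\<^sub>\<infinity>i\<in>UNIV. f i x) = integrable M (\<lambda>x. \<Sum>i. f i x)"
    using inf_pt by (intro Bochner_Integration.integrable_cong) auto
  show "integrable M (\<lambda>x. \<Sum>\<^sub>\<infinity>i\<in>UNIV. f i x)"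
    unfolding cong by (rule integrable_suminf[OF int AEpt sumN])
  have "summable (\<lambda>i. norm (integral\<^sup>L M (f i)))"
    by (rule summable_comparison_test'[OF sumN]) (simp add: integral_norm_bound)
  then have "(\<Sum>\<^sub>\<infinity>i\<in>UNIV. integral\<^sup>L M (f i)) = (\<Sum>i. integral\<^sup>L M (f i))"
    by (rule infsum_eq_suminf)
  also have "\<dots> = (LINT x|M. (\<Sum>i. f i x))"
    by (rule integral_suminf[OF int AEpt sumN, symmetric])
  also have "\<dots> = (LINT x|M. (\<Sum>\<^sub>\<infinity>i\<in>UNIV. f i x))"
    using inf_pt by (intro Bochner_Integration.integral_cong) auto
  finally show "(\<Sum>\<^sub>\<infinity>i\<in>UNIV. integral\<^sup>L M (f i)) = (LINT x|M. (\<Sum>\<^sub>\<infinity>i\<in>UNIV. f i x))" .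
qed

lemma integral_infsum_int:
  fixes f :: "int \<Rightarrow> 'a \<Rightarrow> 'b :: {banach, second_countable_topology}"
  assumes meas: "\<And>n. f n \<in> borel_measurable M"
    and fin: "(\<Sum>\<^sub>\<infinity>n\<in>{n0..}. \<integral>\<^sup>+x. ennreal (norm (f n x)) \<partial>M) < \<infinity>"
    and pt: "\<And>x. x \<in> space M \<Longrightarrow> (\<lambda>n. norm (f n x)) summable_on {n0..}"
  shows "integrable M (\<lambda>x. \<Sum>\<^sub>\<infinity>n\<in>{n0..}. f n x)"
    and "(\<Sum>\<^sub>\<infinity>n\<in>{n0..}. integral\<^sup>L M (f n)) = (LINT x|M. (\<Sum>\<^sub>\<infinity>n\<in>{n0..}. f n x))"
proof -
  have bij: "bij_betw (\<lambda>i. n0 + int i) UNIV {n0..}"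
    by (rule bij_betw_byWitness[where f' = "\<lambda>n. nat (n - n0)"]) auto
  note reindex = infsum_reindex_bij_betw[OF bij, symmetric]
  have fin': "(\<Sum>\<^sub>\<infinity>i\<in>UNIV. \<integral>\<^sup>+x. ennreal (norm (f (n0 + int i) x)) \<partial>M) < \<infinity>"
    using fin by (simp only: reindex)
  have pt': "(\<lambda>i. norm (f (n0 + int i) x)) summable_on UNIV" if "x \<in> space M" for x
    using pt[OF that] summable_on_reindex_bij_betw[OF bij, of "\<lambda>n. norm (f n x)"] by simp
  note nat = integral_infsum_nat[of "\<lambda>i. f (n0 + int i)", OF meas fin' pt']
  show "integrable M (\<lambda>x. \<Sum>\<^sub>\<infinity>n\<in>{n0..}. f n x)"
    using nat(1) by (simp only: reindex)
  show "(\<Sum>\<^sub>\<infinity>n\<in>{n0..}. integral\<^sup>L M (f n)) = (LINT x|M. (\<Sum>\<^sub>\<infinity>n\<in>{n0..}. f n x))"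
    using nat(2) by (simp only: reindex)
qed

section \<open>The L-series as an integral of F along the imaginary axis\<close>

lemma nome_imag: "nome (\<i> * of_real t) = of_real (exp (- 2 * pi * t))"
proof -
  have "2 * of_real pi * \<i> * (\<i> * of_real t) = (of_real (- 2 * pi * t) :: complex)"
    by (simp add: algebra_simps)
  then show ?thesis
    by (simp only: exp_of_real)
qed

text \<open>Measurability of a test function is recovered from the convergence of one Laplace
  integral: the exponential factor is continuous and never zero, so it can be cancelled.\<close>

lemma laplace_abs_conv_measurable:
  assumes "laplace_abs_conv \<phi> s"
  shows "(\<lambda>t. indicator {0<..} t *\<^sub>R \<phi> t) \<in> borel_measurable lborel"
proof -
  have "(\<lambda>t. exp (s * of_real t) * (indicator {0<..} t *\<^sub>R (exp (- s * of_real t) * \<phi> t)))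
          \<in> borel_measurable lborel"
    using borel_measurable_integrable[OF assms[unfolded laplace_abs_conv_def set_integrable_def]]
    by (rule borel_measurable_times[rotated]) measurable
  also have "(\<lambda>t. exp (s * of_real t) * (indicator {0<..} t *\<^sub>R (exp (- s * of_real t) * \<phi> t))) =
      (\<lambda>t. indicator {0<..} t *\<^sub>R \<phi> t)"
    by (simp add: fun_eq_iff exp_minus)
  finally show ?thesis .
qed

text \<open>Treats one exponent k and one coefficient family c. The n-th term is the integral of
  c(n) exp(-2 pi n t) t^k phi(t), and its L1 norm is exactly the n-th term of \<open>fin\<close>;
  hence the sum may be moved under the integral.\<close>

lemma infsum_laplace:
  fixes c :: "int \<Rightarrow> complex" and k n0 :: int
  assumes meas: "(\<lambda>t. indicator {0<..} t *\<^sub>R \<phi> t) \<in> borel_measurable lborel"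
    and fin: "(\<Sum>\<^sub>\<infinity>n\<in>{n0..}. ennreal (norm (c n)) * laplace_abs (times_power k \<phi>) (2 * pi * of_int n)) < \<infinity>"
    and pt: "\<And>t. t > 0 \<Longrightarrow> (\<lambda>n. c n * of_real (exp (- 2 * pi * t)) powi n) summable_on {n0..}"
  defines "g \<equiv> \<lambda>t. of_real t powi k * (\<Sum>\<^sub>\<infinity>n\<in>{n0..}. c n * of_real (exp (- 2 * pi * t)) powi n)"
  shows "set_integrable lborel {0<..} (\<lambda>t. g t * \<phi> t)"
    and "(\<Sum>\<^sub>\<infinity>n\<in>{n0..}. c n * laplace (times_power k \<phi>) (2 * of_real pi * of_int n)) =
         (LINT t:{0<..}|lborel. g t * \<phi> t)"
proof -
  \<comment> \<open>Extension of phi by zero turns integrals over (0, infinity) into integrals over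
    the whole line, and makes the summability conditions trivial for t at most 0.\<close>
  define \<psi> where "\<psi> t = indicator {0<..} t *\<^sub>R \<phi> t" for t
  define h where "h n t = exp (- (2 * of_real pi * of_int n) * of_real t) * (of_real t powi k * \<psi> t)"
    for n :: int and t :: real
  define f where "f n t = c n * h n t" for n t
  have [measurable]: "\<psi> \<in> borel_measurable lborel"
    unfolding \<psi>_def by (rule meas)
  have powk [measurable]: "(\<lambda>t :: real. (of_real t :: complex) powi k) \<in> borel_measurable lborel"
    unfolding power_int_def by measurable
  have h_meas [measurable]: "h n \<in> borel_measurable lborel" for n
    unfolding h_def by measurable
  have f_meas: "f n \<in> borel_measurable lborel" for n
    unfolding f_def by measurable
  have normh: "ennreal (norm (h n t)) =
      ennreal (exp (- (2 * pi * of_int n) * t) * norm (times_power k \<phi> t)) * indicator {0<..} t" for n t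
    by (auto simp: h_def \<psi>_def times_power_def norm_mult split: split_indicator)
  have lap_abs: "laplace_abs (times_power k \<phi>) (2 * pi * of_int n) = (\<integral>\<^sup>+t. ennreal (norm (h n t)) \<partial>lborel)" for n
    unfolding laplace_abs_def normh ..
  \<comment> \<open>This also covers c(n) = 0 with a divergent Laplace integral, since 0 times
    infinity is 0 in \<open>ennreal\<close>.\<close>
  have nnf: "(\<integral>\<^sup>+t. ennreal (norm (f n t)) \<partial>lborel) =
      ennreal (norm (c n)) * laplace_abs (times_power k \<phi>) (2 * pi * of_int n)" for n
    unfolding lap_abs f_def norm_mult by (simp add: ennreal_mult nn_integral_cmult)
  have fin': "(\<Sum>\<^sub>\<infinity>n\<in>{n0..}. \<integral>\<^sup>+t. ennreal (norm (f n t)) \<partial>lborel) < \<infinity>"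
    unfolding nnf by (rule fin)
  have f_eq: "f n t = (c n * of_real (exp (- 2 * pi * t)) powi n) * (of_real t powi k * \<psi> t)" for n t
    by (simp add: f_def h_def exp_power_int mult_ac flip: exp_of_real)
  have f_sum: "(\<lambda>n. f n t) summable_on {n0..}" for t
  proof (cases "t > 0")
    case True
    then show ?thesis unfolding f_eq by (intro summable_on_cmult_left pt)
  next
    case False
    then show ?thesis by (simp add: f_eq \<psi>_def)
  qed
  then have pt': "(\<lambda>n. norm (f n t)) summable_on {n0..}" for t
    by (simp flip: summable_on_iff_abs_summable_on_complex)
  have inf_f: "(\<Sum>\<^sub>\<infinity>n\<in>{n0..}. f n t) = indicator {0<..} t *\<^sub>R (g t * \<phi> t)" for t
  proof (cases "t > 0")
    case True
    then show ?thesis unfolding f_eq using pt[OF True] by (subst infsum_cmult_left) (simp_all add: g_def \<psi>_def)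
  next
    case False
    then show ?thesis by (simp add: f_eq \<psi>_def)
  qed
  \<comment> \<open>Pulling out c(n) requires no integrability of \<open>h n\<close>, which may fail
    where c(n) = 0.\<close>
  have int_f: "integral\<^sup>L lborel (f n) = c n * laplace (times_power k \<phi>) (2 * of_real pi * of_int n)" for n
    unfolding f_def laplace_def set_lebesgue_integral_def integral_mult_right_zero
    by (intro arg_cong[where f = "\<lambda>x. c n * x"] Bochner_Integration.integral_cong)
       (auto simp: h_def \<psi>_def times_power_def)
  note res = integral_infsum_int[OF f_meas fin' pt']
  show "set_integrable lborel {0<..} (\<lambda>t. g t * \<phi> t)"
    using res(1) unfolding inf_f set_integrable_def .
  show "(\<Sum>\<^sub>\<infinity>n\<in>{n0..}. c n * laplace (times_power k \<phi>) (2 * of_real pi * of_int n)) =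
      (LINT t:{0<..}|lborel. g t * \<phi> t)"
    using res(2) unfolding inf_f int_f set_lebesgue_integral_def .
qed

text \<open>Sums \<open>infsum_laplace\<close> over the finite set S and both coefficient families,
  then recognises the expansion of F at z = it.\<close>

lemma L_series_eq_integral:
  assumes S: "finite S"
    and exp: "has_expansion F S n0 a b"
    and \<phi>: "\<phi> \<in> test_functions S n0 a b"
  shows "set_integrable lborel {0<..} (\<lambda>t. F (\<i> * of_real t) * \<phi> t)"
    and "L_series S n0 a b \<phi> = (LINT t:{0<..}|lborel. F (\<i> * of_real t) * \<phi> t)"
proof -
  \<comment> \<open>At z = it the nome is real, hence equal to its conjugate, so one formula serves
    for both coefficient families \<open>a\<close> and \<open>b\<close>.\<close>
  define G where "G c k t = of_real t powi k *
      (\<Sum>\<^sub>\<infinity>n\<in>{n0..}. c k n * of_real (exp (- 2 * pi * t)) powi n)"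
    for c :: "int \<Rightarrow> int \<Rightarrow> complex" and k :: int and t :: real
  have "laplace_abs_conv \<phi> (2 * pi * of_int n0)"
    using \<phi> by (simp add: test_functions_def)
  then have meas: "(\<lambda>t. indicator {0<..} t *\<^sub>R \<phi> t) \<in> borel_measurable lborel"
    by (rule laplace_abs_conv_measurable)
  \<comment> \<open>All terms are nonnegative, so finiteness of the total in
    \<open>test_functions\<close> passes to each inner sum.\<close>
  have "(\<Sum>\<^sub>\<infinity>n\<in>{n0..}. ennreal (norm (c k n)) * laplace_abs (times_power k \<phi>) (2 * pi * of_int n)) < \<infinity>"
    if "k \<in> S" "c = a \<or> c = b" for k c
    using \<phi> that S by (auto simp: test_functions_def)
  moreover have "(\<lambda>n. c k n * of_real (exp (- 2 * pi * t)) powi n) summable_on {n0..}"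
    if "k \<in> S" "c = a \<or> c = b" "t > 0" for k c t
  proof -
    have "\<i> * of_real t \<in> upper_half_plane" using that by simp
    from exp[unfolded has_expansion_def, rule_format, OF this, THEN conjunct1, rule_format, OF that(1)]
    show ?thesis
      using that(2) unfolding nome_imag complex_cnj_complex_of_real by blast
  qed
  ultimately have
    int: "set_integrable lborel {0<..} (\<lambda>t. G c k t * \<phi> t)" and
    eq: "(\<Sum>\<^sub>\<infinity>n\<in>{n0..}. c k n * laplace (times_power k \<phi>) (2 * of_real pi * of_int n)) =
         (LINT t:{0<..}|lborel. G c k t * \<phi> t)"
    if "k \<in> S" "c = a \<or> c = b" for k c
    using that infsum_laplace[OF meas, where ?n0.0 = n0 and c = "c k" and k = k] unfolding G_def by blast+
  have F_eq: "F (\<i> * of_real t) = (\<Sum>k\<in>S. G a k t) + (\<Sum>k\<in>S. G b k t)" if "t > 0" for t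
  proof -
    have "\<i> * of_real t \<in> upper_half_plane" using that by simp
    from exp[unfolded has_expansion_def, rule_format, OF this, THEN conjunct2]
    show ?thesis unfolding nome_imag complex_cnj_complex_of_real by (simp add: G_def)
  qed
  have ind_eq: "indicator {0<..} t *\<^sub>R (F (\<i> * of_real t) * \<phi> t) =
      (\<Sum>k\<in>S. indicator {0<..} t *\<^sub>R (G a k t * \<phi> t)) +
      (\<Sum>k\<in>S. indicator {0<..} t *\<^sub>R (G b k t * \<phi> t))" for t
    by (cases "t > 0") (auto simp: F_eq distrib_right sum_distrib_right)
  note int' = int[unfolded set_integrable_def]
  show "set_integrable lborel {0<..} (\<lambda>t. F (\<i> * of_real t) * \<phi> t)"
    unfolding set_integrable_def ind_eq
    by (intro Bochner_Integration.integrable_add Bochner_Integration.integrable_sum int') auto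
  show "L_series S n0 a b \<phi> = (LINT t:{0<..}|lborel. F (\<i> * of_real t) * \<phi> t)"
    unfolding L_series_def set_lebesgue_integral_def ind_eq
    by (subst Bochner_Integration.integral_add)
       (auto intro!: Bochner_Integration.integrable_sum int'
             simp: Bochner_Integration.integral_sum[OF int'] eq set_lebesgue_integral_def)
qed

section \<open>The inversion t -> 1/t and the functional equation\<close>

lemma set_integral_inverse_Ioi:
  fixes f :: "real \<Rightarrow> 'a :: euclidean_space"
  assumes f: "set_integrable lborel {0<..} f"
    and g: "set_integrable lborel {0<..} (\<lambda>t. (1 / t\<^sup>2) *\<^sub>R f (1 / t))"
  shows "(LINT t:{0<..}|lborel. (1 / t\<^sup>2) *\<^sub>R f (1 / t)) = (LINT t:{0<..}|lborel. f t)"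
proof -
  \<comment> \<open>The change of variables theorem concerns the gauge integral and Lebesgue
    measure. Borel measurability of the integrand allows passage between \<open>lborel\<close> and
    its completion; \<open>g\<close> is what brings the transformed integral back.\<close>
  have lift: "h absolutely_integrable_on {0<..}"
    "(LINT t:{0<..}|lborel. h t) = integral {0<..} h"
    if "set_integrable lborel {0<..} h" for h :: "real \<Rightarrow> 'a"
  proof -
    have h: "(\<lambda>t. indicator {0<..} t *\<^sub>R h t) \<in> borel_measurable lborel"
      using that unfolding set_integrable_def by (rule borel_measurable_integrable)
    show *: "h absolutely_integrable_on {0<..}"
      using that unfolding set_integrable_def by (simp add: integrable_completion[OF h])
    show "(LINT t:{0<..}|lborel. h t) = integral {0<..} h"
      using set_lebesgue_integral_eq_integral(2)[OF *]
      unfolding set_lebesgue_integral_def by (simp add: integral_completion[OF h])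
  qed
  have img: "(\<lambda>t :: real. 1 / t) ` {0<..} = {0<..}"
    by (force intro: image_eqI[where x = "1 / _"])
  \<comment> \<open>The absolute value of the derivative absorbs the reversal of orientation. Taking
    the value to be the integral of f itself makes the second conjunct on the right trivial after
    rewriting with \<open>img\<close>.\<close>
  have "(\<lambda>t. \<bar>- (1 / t\<^sup>2)\<bar> *\<^sub>R f (1 / t)) absolutely_integrable_on {0<..} \<and>
      integral {0<..} (\<lambda>t. \<bar>- (1 / t\<^sup>2)\<bar> *\<^sub>R f (1 / t)) = integral {0<..} f \<longleftrightarrow>
      f absolutely_integrable_on (\<lambda>t. 1 / t) ` {0<..} \<and> integral ((\<lambda>t. 1 / t) ` {0<..}) f = integral {0<..} f"
    by (rule has_absolute_integral_change_of_variables_real)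
       (auto intro!: derivative_eq_intros simp: inj_on_def power2_eq_square)
  then have "integral {0<..} (\<lambda>t. (1 / t\<^sup>2) *\<^sub>R f (1 / t)) = integral {0<..} f"
    using lift(1)[OF f] unfolding img by simp
  then show ?thesis
    by (simp add: lift(2)[OF f] lift(2)[OF g])
qed

lemma modular_form_inversion:
  assumes F: "F \<in> real_analytic_modular_forms r s" and t: "t > 0"
  shows "F (\<i> * of_real (1 / t)) = \<i> powi (r - s) * of_real t powi (r + s) * F (\<i> * of_real t)"
proof -
  define z where "z = \<i> * of_real t"
  have z: "z \<in> upper_half_plane" "z \<noteq> 0" using t by (auto simp: z_def)
  have "F ((of_int 0 * z + of_int (- 1)) / (of_int 1 * z + of_int 0))
      * (of_int 1 * z + of_int 0) powi (- r) * (of_int 1 * cnj z + of_int 0) powi (- s) = F z"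
    \<comment> \<open>The matrix with rows (0, -1) and (1, 0): it sends z to -1/z and has cz + d =
      z.\<close>
    using F[unfolded real_analytic_modular_forms_def mem_Collect_eq, THEN conjunct2, THEN conjunct1,
        rule_format, of 0 0 "- 1" 1, OF _ z(1)] by simp
  moreover have "- 1 / z = \<i> * of_real (1 / t)"
    using t by (simp add: z_def field_simps)
  ultimately have "F (\<i> * of_real (1 / t)) * z powi (- r) * cnj z powi (- s) = F z"
    by simp
  then have "F (\<i> * of_real (1 / t)) = z powi r * cnj z powi s * F z"
    using z(2) by (simp add: power_int_minus field_simps)
  \<comment> \<open>Conjugation turns i into its inverse, so the second weight contributes i^(-s)
    and the total factor is i^(r-s). Keeping \<open>inverse \<i>\<close> unsimplified lets the
    powers of i combine.\<close>
  also have "cnj z = inverse \<i> * of_real t"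
    by (simp add: z_def)
  also have "z powi r * (inverse \<i> * of_real t) powi s = \<i> powi (r - s) * of_real t powi (r + s)"
    using t by (simp add: z_def power_int_mult_distrib power_int_add power_int_diff power_int_inverse divide_inverse del: inverse_i)
  finally show ?thesis by (simp add: z_def)
qed

theorem theorem1p2:
  fixes r s n0 :: int
    and F :: "complex \<Rightarrow> complex"
    and S :: "int set"
    and a b :: "int \<Rightarrow> int \<Rightarrow> complex"
    and \<phi> :: "real \<Rightarrow> complex"
  assumes "F \<in> real_analytic_modular_forms r s"
    and "finite S"
    and "has_expansion F S n0 a b"
    and "\<phi> \<in> test_functions S n0 a b"
    and "slash_W1 \<phi> (2 - r - s) \<in> test_functions S n0 a b"
  shows "L_series S n0 a b \<phi> = \<i> powi (r - s) * L_series S n0 a b (slash_W1 \<phi> (2 - r - s))"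
proof -
  let ?f = "\<lambda>t. F (\<i> * of_real t) * \<phi> t"
  let ?\<psi> = "slash_W1 \<phi> (2 - r - s)"
  let ?g = "\<lambda>t. F (\<i> * of_real t) * ?\<psi> t"
  note f = L_series_eq_integral[OF assms(2,3,4)]
  note g = L_series_eq_integral[OF assms(2,3,5)]
  have sub: "(1 / t\<^sup>2) *\<^sub>R ?f (1 / t) = \<i> powi (r - s) * ?g t" if "t > 0" for t
  proof -
    \<comment> \<open>The slash exponent r + s - 2 splits into t^(r+s), which modularity supplies,
      and t^(-2), which is the Jacobian.\<close>
    have "(of_real t :: complex) powi (- (2 - r - s)) = of_real t powi (r + s - 2)"
      by (simp add: algebra_simps)
    also have "\<dots> = of_real t powi (r + s) * of_real (1 / t\<^sup>2)"
      using that by (simp add: power_int_diff)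
    finally have "?\<psi> t = of_real t powi (r + s) * of_real (1 / t\<^sup>2) * \<phi> (1 / t)"
      by (simp add: slash_W1_def)
    then show ?thesis
      unfolding modular_form_inversion[OF assms(1) that] by (simp add: scaleR_conv_of_real)
  qed
  \<comment> \<open>Integrability after the substitution comes from the slashed function being a
    test function too.\<close>
  have "set_integrable lborel {0<..} (\<lambda>t. \<i> powi (r - s) * ?g t)"
    using g(1) by (rule set_integrable_mult_right)
  then have int: "set_integrable lborel {0<..} (\<lambda>t. (1 / t\<^sup>2) *\<^sub>R ?f (1 / t))"
    by (subst set_integrable_cong[OF refl refl sub]) auto
  have "L_series S n0 a b \<phi> = (LINT t:{0<..}|lborel. (1 / t\<^sup>2) *\<^sub>R ?f (1 / t))"
    using f(2) set_integral_inverse_Ioi[OF f(1) int] by simp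
  also have "\<dots> = (LINT t:{0<..}|lborel. \<i> powi (r - s) * ?g t)"
    using sub by (intro set_lebesgue_integral_cong) auto
  also have "\<dots> = \<i> powi (r - s) * L_series S n0 a b ?\<psi>"
    by (simp add: g(2))
  finally show ?thesis .
qed

end
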